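(* If $f\colon\mathbb R\langle\mathbb A\rangle_*\,\overline\otimes\,\mathbb R\langle\mathbb A\rangle\to\mathbb R\langle\mathbb A\rangle_*\,\overline\otimes\,\mathbb R\langle\mathbb A\rangle$ has a power series $f(x)=\sum_{k\ge0}c_kx^k$ with $c_k\in\mathbb R$, then $$f\Bigl(\sum_{w\in\mathbb A^*}w\otimes w\Bigr)=\sum_{w\in\mathbb A^*}F^{\star}(\mathrm{id})(w)\otimes w ,$$ where $F^{\star}(X)=\sum_{k\ge0}c_kX^{\star k}$ is the associated convolution power series. Further, when the power series $f$ has an inverse $f^{-1}(x)=\sum_{k\ge0}b_kx^k$ with $b_k\in\mathbb R$, the compositional inverse of the convolution power series $F^\star$ is given by the associated convolution power series $F^{-1}(X)=\sum_{k\ge0}b_kX^{\star k}$.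
   Context: $\mathbb A$ is a countable alphabet, $\mathbb A^*$ the set of words over $\mathbb A$ (with empty word $\mathbf 1$), $\mathbb R\langle\mathbb A\rangle$ the real vector space with basis $\mathbb A^*$, regarded as an algebra under concatenation. Given a commutative associative product $[\cdot,\cdot]$ on the span of the letters, $\mathbb R\langle\mathbb A\rangle_*$ is the same vector space with the quasi-shuffle product, determined by $u*\mathbf 1=\mathbf 1*u=u$ and $ua*vb=(u*vb)a+(ua*v)b+(u*v)[a,b]$ for words $u,v$ and letters $a,b$. $\mathbb R\langle\mathbb A\rangle_*\,\overline\otimes\,\mathbb R\langle\mathbb A\rangle$ is the completed tensor product (infinite linear combinations of $u\otimes v$ allowed), with product $(u\otimes x)(v\otimes y)=(u*v)\otimes(xy)$. The convolution product of linear endomorphisms $X,Y$ of $\mathbb R\langle\mathbb A\rangle_*$ is $(X\star Y)(w)=\sum_{uv=w}X(u)*Y(v)$, the sum being over all factorizations of the word $w$ by concatenation (including empty factors). $X^{\star k}$ denotes the $k$-th convolution power, $X^{\star 0}=\nu$ being the convolution unit, which fixes $\mathbf 1$ and sends nonempty words to $0$. "Has a power series" includes that the series involved are well defined (convergent) at the elements to which they are applied. *)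

theory Defs
  imports
    "HOL-Analysis.Analysis"
    "HOL-Analysis.Finite_Function_Topology"
    "HOL-Computational_Algebra.Formal_Power_Series"
begin

section \<open>Words and the quasi-shuffle product\<close>

type_synonym 'a letters = "'a \<Rightarrow>\<^sub>0 real"
type_synonym 'a words = "'a list \<Rightarrow>\<^sub>0 real"

abbreviation letter :: "'a \<Rightarrow> 'a letters" where
  "letter a \<equiv> Poly_Mapping.single a 1"

abbreviation word :: "'a list \<Rightarrow> 'a words" where
  "word w \<equiv> Poly_Mapping.single w 1"

definition lin_ext :: "('b \<Rightarrow> 'v::real_vector) \<Rightarrow> ('b \<Rightarrow>\<^sub>0 real) \<Rightarrow> 'v" where
  "lin_ext h p = (\<Sum>x\<in>Poly_Mapping.keys p. Poly_Mapping.lookup p x *\<^sub>R h x)"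

definition concat_mult :: "'a words \<Rightarrow> 'a words \<Rightarrow> 'a words" where
  "concat_mult p q = lin_ext (\<lambda>u. lin_ext (\<lambda>v. word (u @ v)) q) p"

definition letters_to_words :: "'a letters \<Rightarrow> 'a words" where
  "letters_to_words = lin_ext (\<lambda>a. word [a])"

definition comm_assoc_product :: "('a letters \<Rightarrow> 'a letters \<Rightarrow> 'a letters) \<Rightarrow> bool" where
  "comm_assoc_product br \<longleftrightarrow>
     bilinear br \<and> (\<forall>p q. br p q = br q p) \<and> (\<forall>p q r. br (br p q) r = br p (br q r))"

text \<open>The recursion peels off the last letters of both words. The arguments of the auxiliary
  function are the reversed words; its values are not reversed.\<close>

fun qshuffle_rev ::
  "('a letters \<Rightarrow> 'a letters \<Rightarrow> 'a letters) \<Rightarrow> 'a list \<Rightarrow> 'a list \<Rightarrow> 'a words" where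
  "qshuffle_rev br [] v = word (rev v)"
| "qshuffle_rev br (a # u) [] = word (rev (a # u))"
| "qshuffle_rev br (a # u) (b # v) =
     concat_mult (qshuffle_rev br u (b # v)) (word [a])
   + concat_mult (qshuffle_rev br (a # u) v) (word [b])
   + concat_mult (qshuffle_rev br u v) (letters_to_words (br (letter a) (letter b)))"

definition qshuffle ::
  "('a letters \<Rightarrow> 'a letters \<Rightarrow> 'a letters) \<Rightarrow> 'a list \<Rightarrow> 'a list \<Rightarrow> 'a words" where
  "qshuffle br u v = qshuffle_rev br (rev u) (rev v)"

lemma qshuffle_Nil_left: "qshuffle br [] v = word v"
  by (simp add: qshuffle_def)

lemma qshuffle_Nil_right: "qshuffle br u [] = word u"
  by (cases "rev u") (auto simp: qshuffle_def)

lemma qshuffle_snoc_snoc: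
  "qshuffle br (u @ [a]) (v @ [b]) =
     concat_mult (qshuffle br u (v @ [b])) (word [a])
   + concat_mult (qshuffle br (u @ [a]) v) (word [b])
   + concat_mult (qshuffle br u v) (letters_to_words (br (letter a) (letter b)))"
  by (simp add: qshuffle_def)

definition qs_mult ::
  "('a letters \<Rightarrow> 'a letters \<Rightarrow> 'a letters) \<Rightarrow> 'a words \<Rightarrow> 'a words \<Rightarrow> 'a words" where
  "qs_mult br p q = lin_ext (\<lambda>u. lin_ext (\<lambda>v. qshuffle br u v) q) p"

section \<open>The completed tensor product\<close>

text \<open>An arbitrary, possibly infinite, linear combination of the \<open>u \<otimes> v\<close> is given by the
  family of its coefficients.\<close>

type_synonym 'a ctensor = "'a list \<times> 'a list \<Rightarrow> real"

definition pure_tensor :: "'a words \<Rightarrow> 'a words \<Rightarrow> 'a ctensor" (infixl \<open>\<otimes>\<close> 70) where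
  "p \<otimes> q = (\<lambda>(u, v). Poly_Mapping.lookup p u * Poly_Mapping.lookup q v)"

definition ct_sum :: "('a list \<Rightarrow> 'a ctensor) \<Rightarrow> 'a ctensor" where
  "ct_sum t = (\<lambda>i. \<Sum>\<^sub>\<infinity>w. t w i)"

text \<open>The product extends \<open>(u \<otimes> x)(v \<otimes> y) = (u * v) \<otimes> (x y)\<close> to infinite linear
  combinations. Over an infinite alphabet infinitely many terms may contribute to one
  coefficient, so that the product is only partially defined.\<close>

definition ct_mult_term ::
  "('a letters \<Rightarrow> 'a letters \<Rightarrow> 'a letters) \<Rightarrow> 'a ctensor \<Rightarrow> 'a ctensor \<Rightarrow>
   'a list \<times> 'a list \<Rightarrow> ('a list \<times> 'a list) \<times> ('a list \<times> 'a list) \<Rightarrow> real" where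
  "ct_mult_term br s t i =
     (\<lambda>((u, x), (v, y)). s (u, x) * t (v, y) * (qshuffle br u v \<otimes> word (x @ y)) i)"

definition ct_mult_defined ::
  "('a letters \<Rightarrow> 'a letters \<Rightarrow> 'a letters) \<Rightarrow> 'a ctensor \<Rightarrow> 'a ctensor \<Rightarrow> bool" where
  "ct_mult_defined br s t \<longleftrightarrow> (\<forall>i. ct_mult_term br s t i summable_on UNIV)"

definition ct_mult ::
  "('a letters \<Rightarrow> 'a letters \<Rightarrow> 'a letters) \<Rightarrow> 'a ctensor \<Rightarrow> 'a ctensor \<Rightarrow> 'a ctensor" where
  "ct_mult br s t = (\<lambda>i. infsum (ct_mult_term br s t i) UNIV)"

primrec ct_power ::
  "('a letters \<Rightarrow> 'a letters \<Rightarrow> 'a letters) \<Rightarrow> 'a ctensor \<Rightarrow> nat \<Rightarrow> 'a ctensor" where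
  "ct_power br s 0 = word [] \<otimes> word []"
| "ct_power br s (Suc k) = ct_mult br s (ct_power br s k)"

text \<open>On the domain \<open>D\<close> all powers are defined and the series converges coefficientwise
  to \<open>f\<close>.\<close>

definition has_power_series_on ::
  "('a letters \<Rightarrow> 'a letters \<Rightarrow> 'a letters) \<Rightarrow> ('a ctensor \<Rightarrow> 'a ctensor) \<Rightarrow> (nat \<Rightarrow> real) \<Rightarrow>
   'a ctensor set \<Rightarrow> bool" where
  "has_power_series_on br f c D \<longleftrightarrow>
     (\<forall>s\<in>D. (\<forall>k. ct_mult_defined br s (ct_power br s k)) \<and>
            (\<forall>i. (\<lambda>k. c k * ct_power br s k i) sums f s i))"

section \<open>Convolution of endomorphisms\<close>

definition conv ::
  "('a letters \<Rightarrow> 'a letters \<Rightarrow> 'a letters) \<Rightarrow> ('a words \<Rightarrow> 'a words) \<Rightarrow> ('a words \<Rightarrow> 'a words) \<Rightarrow>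
   'a words \<Rightarrow> 'a words" where
  "conv br X Y =
     lin_ext (\<lambda>w. \<Sum>(u, v)\<in>{(u, v). u @ v = w}. qs_mult br (X (word u)) (Y (word v)))"

definition conv_unit :: "'a words \<Rightarrow> 'a words" where
  "conv_unit = lin_ext (\<lambda>w. if w = [] then word [] else 0)"

primrec conv_power ::
  "('a letters \<Rightarrow> 'a letters \<Rightarrow> 'a letters) \<Rightarrow> ('a words \<Rightarrow> 'a words) \<Rightarrow> nat \<Rightarrow>
   'a words \<Rightarrow> 'a words" where
  "conv_power br X 0 = conv_unit"
| "conv_power br X (Suc k) = conv br X (conv_power br X k)"

text \<open>Convergence of a convolution power series is coefficientwise at every argument; the limit
  has to be an endomorphism again, i.e. its values have to be finite linear combinations.\<close>

definition conv_series_sums ::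
  "('a letters \<Rightarrow> 'a letters \<Rightarrow> 'a letters) \<Rightarrow> (nat \<Rightarrow> real) \<Rightarrow> ('a words \<Rightarrow> 'a words) \<Rightarrow>
   ('a words \<Rightarrow> 'a words) \<Rightarrow> bool" where
  "conv_series_sums br c X Y \<longleftrightarrow> linear Y \<and>
     (\<forall>p v. (\<lambda>k. c k * Poly_Mapping.lookup (conv_power br X k p) v)
              sums Poly_Mapping.lookup (Y p) v)"

definition conv_series_converges ::
  "('a letters \<Rightarrow> 'a letters \<Rightarrow> 'a letters) \<Rightarrow> (nat \<Rightarrow> real) \<Rightarrow> ('a words \<Rightarrow> 'a words) \<Rightarrow> bool" where
  "conv_series_converges br c X \<longleftrightarrow> (\<exists>Y. conv_series_sums br c X Y)"

definition conv_series ::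
  "('a letters \<Rightarrow> 'a letters \<Rightarrow> 'a letters) \<Rightarrow> (nat \<Rightarrow> real) \<Rightarrow> ('a words \<Rightarrow> 'a words) \<Rightarrow>
   'a words \<Rightarrow> 'a words" where
  "conv_series br c X = (THE Y. conv_series_sums br c X Y)"

text \<open>\<open>G\<close> is a left compositional inverse of \<open>F\<close> at \<open>X\<close>, for the convolution power series
  \<open>F\<close> and \<open>G\<close> with coefficients \<open>c\<close> and \<open>b\<close>.\<close>

definition conv_series_inverts_at ::
  "('a letters \<Rightarrow> 'a letters \<Rightarrow> 'a letters) \<Rightarrow> (nat \<Rightarrow> real) \<Rightarrow> (nat \<Rightarrow> real) \<Rightarrow>
   ('a words \<Rightarrow> 'a words) \<Rightarrow> bool" where
  "conv_series_inverts_at br b c X \<longleftrightarrow>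
     conv_series_converges br b (conv_series br c X) \<and>
     conv_series br b (conv_series br c X) = X"

end

theory Submission
  imports Defs
begin

text \<open>
  An endomorphism \<open>X\<close> is encoded by the tensor \<open>\<Sum>w. X(w) \<otimes> w\<close>, whose coefficient at \<open>u \<otimes> w\<close>
  is the coefficient of \<open>u\<close> in \<open>X(w)\<close>. A word has only finitely many factorizations, so products
  of such tensors are always defined, and they correspond to convolution. Hence the power series
  at the tensor of \<open>X\<close> is, coefficient by coefficient, the convolution power series at \<open>X\<close>; this gives
  the first claim and the inversion for functions \<open>f\<close>, \<open>g\<close>. Convergence at the identity also needs
  the limit to have finite support: all convolution powers of the identity at \<open>w\<close> are
  supported on one finite set.

  For formally inverse series, \<open>X(1) = 0\<close> makes \<open>X\<close> locally nilpotent, so all series are finite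
  sums on each word. As the quasi-shuffle product, and with it convolution, is
  associative, substituting series in \<open>X\<close> is composing formal power series.
\<close>

section \<open>Linear extension from a basis\<close>

lemma lookup_scaleR [simp]:
  "Poly_Mapping.lookup (r *\<^sub>R p) x = r * Poly_Mapping.lookup (p :: 'b \<Rightarrow>\<^sub>0 real) x"
proof -
  have "finite {x. r * Poly_Mapping.lookup p x \<noteq> 0}"
    by (rule finite_subset [OF _ finite_lookup [of p]]) auto
  then show ?thesis
    by (simp add: scaleR_poly_mapping_def)
qed

text \<open>Enlarging the index set lets vectors with different supports be compared over one common
  finite set.\<close>

lemma lin_ext_eq_sum:
  assumes "finite S" "Poly_Mapping.keys p \<subseteq> S"
  shows "lin_ext h p = (\<Sum>x\<in>S. Poly_Mapping.lookup p x *\<^sub>R h x)"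
  unfolding lin_ext_def
  by (rule sum.mono_neutral_left) (use assms in \<open>auto simp: in_keys_iff\<close>)

lemma linear_lin_ext: "linear (lin_ext h)"
proof (rule linearI)
  fix p q :: "'a \<Rightarrow>\<^sub>0 real" and r
  let ?S = "Poly_Mapping.keys p \<union> Poly_Mapping.keys q"
  have S: "finite ?S" "Poly_Mapping.keys (p + q) \<subseteq> ?S"
    by (simp_all add: keys_add)
  show "lin_ext h (p + q) = lin_ext h p + lin_ext h q"
    using S by (simp add: lin_ext_eq_sum [of ?S] lookup_add scaleR_left_distrib sum.distrib)
  have "Poly_Mapping.keys (r *\<^sub>R p) \<subseteq> Poly_Mapping.keys p"
    by (auto simp: in_keys_iff)
  then show "lin_ext h (r *\<^sub>R p) = r *\<^sub>R lin_ext h p"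
    by (simp add: lin_ext_eq_sum [of "Poly_Mapping.keys p"] scaleR_sum_right)
qed

lemma lin_ext_single [simp]: "lin_ext h (Poly_Mapping.single x 1) = h x"
  by (simp add: lin_ext_def)

lemma lin_ext_basis: "lin_ext (\<lambda>x. Poly_Mapping.single x 1) p = p"
proof (rule poly_mapping_eqI)
  fix k
  show "Poly_Mapping.lookup (lin_ext (\<lambda>x. Poly_Mapping.single x 1) p) k = Poly_Mapping.lookup p k"
    by (simp add: lin_ext_def lookup_sum lookup_single when_def in_keys_iff if_distrib sum.delta
        cong: if_cong)
qed

lemma linear_eq_lin_ext:
  assumes "linear L"
  shows "L p = lin_ext (\<lambda>x. L (Poly_Mapping.single x 1)) p"
proof -
  have "L p = L (lin_ext (\<lambda>x. Poly_Mapping.single x 1) p)"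
    by (simp add: lin_ext_basis)
  then show ?thesis
    by (simp add: lin_ext_def linear_sum [OF assms] linear_scale [OF assms])
qed

lemma linear_eqI_basis:
  fixes L M :: "('b \<Rightarrow>\<^sub>0 real) \<Rightarrow> 'v::real_vector"
  assumes "linear L" "linear M"
    and "\<And>x. L (Poly_Mapping.single x 1) = M (Poly_Mapping.single x 1)"
  shows "L p = M p"
  using assms(3) linear_eq_lin_ext [OF assms(1), of p] linear_eq_lin_ext [OF assms(2), of p] by simp

lemma linear_lookup_sum:
  fixes L :: "('b \<Rightarrow>\<^sub>0 real) \<Rightarrow> ('c \<Rightarrow>\<^sub>0 real)"
  assumes "linear L"
  shows "Poly_Mapping.lookup (L p) v =
    (\<Sum>x\<in>Poly_Mapping.keys p. Poly_Mapping.lookup p x * Poly_Mapping.lookup (L (Poly_Mapping.single x 1)) v)"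
  by (subst linear_eq_lin_ext [OF assms]) (simp add: lin_ext_def lookup_sum)

lemma bilinear_lin_ext: "bilinear (\<lambda>p q. lin_ext (\<lambda>x. lin_ext (h x) q) p)"
proof -
  have "linear (\<lambda>q. lin_ext (\<lambda>x. lin_ext (h x) q) p)" for p
    unfolding lin_ext_def [of _ p]
    by (intro linear_compose_sum ballI linear_compose_scale_right linear_lin_ext)
  then show ?thesis
    by (simp add: bilinear_def linear_lin_ext)
qed

lemma bilinear_left: "bilinear h \<Longrightarrow> linear f \<Longrightarrow> linear (\<lambda>x. h (f x) y)"
  unfolding bilinear_def using linear_compose [of f "\<lambda>x. h x y"] by (auto simp: o_def)

lemma bilinear_right: "bilinear h \<Longrightarrow> linear f \<Longrightarrow> linear (\<lambda>x. h y (f x))"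
  unfolding bilinear_def using linear_compose [of f "h y"] by (auto simp: o_def)

lemma bilinear_sum_left: "bilinear h \<Longrightarrow> h (\<Sum>i\<in>I. f i) y = (\<Sum>i\<in>I. h (f i) y)"
  using linear_sum [of "\<lambda>x. h x y"] by (auto simp: bilinear_def)

lemma bilinear_sum_right: "bilinear h \<Longrightarrow> h y (\<Sum>i\<in>I. f i) = (\<Sum>i\<in>I. h y (f i))"
  using linear_sum [of "h y"] by (auto simp: bilinear_def)

section \<open>Associativity of the quasi-shuffle product\<close>

lemma bilinear_qs_mult: "bilinear (qs_mult br)"
  unfolding qs_mult_def by (rule bilinear_lin_ext)

lemma qs_mult_word_word [simp]: "qs_mult br (word u) (word v) = qshuffle br u v"
  by (simp add: qs_mult_def)

lemma qs_mult_unit_left [simp]: "qs_mult br (word []) p = p"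
  by (simp add: qs_mult_def ext [OF qshuffle_Nil_left] lin_ext_basis)

lemma qs_mult_unit_right [simp]: "qs_mult br p (word []) = p"
  by (simp add: qs_mult_def qshuffle_Nil_right lin_ext_basis)

text \<open>Right multiplication by a linear combination of letters; the recursion of the
  quasi-shuffle product becomes a four-linear identity for it.\<close>

definition append_letters :: "'a words \<Rightarrow> 'a letters \<Rightarrow> 'a words" where
  "append_letters p a = concat_mult p (letters_to_words a)"

lemma bilinear_append_letters: "bilinear append_letters"
proof -
  have c: "bilinear concat_mult"
    unfolding concat_mult_def by (rule bilinear_lin_ext)
  have l: "linear letters_to_words"
    unfolding letters_to_words_def by (rule linear_lin_ext)
  show ?thesis
    unfolding append_letters_def bilinear_def
    by (intro conjI allI bilinear_left [OF c] bilinear_right [OF c] l linear_ident)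
qed

lemma append_letters_letter: "append_letters p (letter a) = concat_mult p (word [a])"
  by (simp add: append_letters_def letters_to_words_def)

lemma append_letters_word_letter: "append_letters (word u) (letter a) = word (u @ [a])"
  by (simp add: append_letters_letter concat_mult_def)

text \<open>The bracket of two letters is only a linear combination of letters, so iterating the
  recursion needs this form. On basis elements it is \<open>qshuffle_snoc_snoc\<close>; linearity
  then frees the four arguments one at a time.\<close>

lemma qs_mult_append_letters:
  assumes br: "bilinear br"
  shows "qs_mult br (append_letters p a) (append_letters q b) =
     append_letters (qs_mult br p (append_letters q b)) a
   + append_letters (qs_mult br (append_letters p a) q) b
   + append_letters (qs_mult br p q) (br a b)"
proof -
  note lin = linear_compose_add linear_ident
    bilinear_left [OF br] bilinear_right [OF br]
    bilinear_left [OF bilinear_qs_mult] bilinear_right [OF bilinear_qs_mult]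
    bilinear_left [OF bilinear_append_letters] bilinear_right [OF bilinear_append_letters]
  let ?L = "\<lambda>p a q b. qs_mult br (append_letters p a) (append_letters q b)"
  let ?R = "\<lambda>p a q b. append_letters (qs_mult br p (append_letters q b)) a
   + append_letters (qs_mult br (append_letters p a) q) b
   + append_letters (qs_mult br p q) (br a b)"
  have 1: "?L (word u) (letter a) (word v) (letter b) = ?R (word u) (letter a) (word v) (letter b)"
    for u a v b
    by (simp add: append_letters_word_letter qshuffle_snoc_snoc)
      (simp add: append_letters_def letters_to_words_def)
  have 2: "?L (word u) (letter a) (word v) b = ?R (word u) (letter a) (word v) b" for u a v
    by (rule linear_eqI_basis [of "\<lambda>x. ?L (word u) (letter a) (word v) x"
          "\<lambda>x. ?R (word u) (letter a) (word v) x", OF _ _ 1])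
      (intro lin)+
  have 3: "?L (word u) (letter a) q b = ?R (word u) (letter a) q b" for u a
    by (rule linear_eqI_basis [of "\<lambda>x. ?L (word u) (letter a) x b"
          "\<lambda>x. ?R (word u) (letter a) x b", OF _ _ 2])
      (intro lin)+
  have 4: "?L (word u) a q b = ?R (word u) a q b" for u
    by (rule linear_eqI_basis [of "\<lambda>x. ?L (word u) x q b"
          "\<lambda>x. ?R (word u) x q b", OF _ _ 3])
      (intro lin)+
  show ?thesis
    by (rule linear_eqI_basis [of "\<lambda>x. ?L x a q b"
          "\<lambda>x. ?R x a q b", OF _ _ 4])
      (intro lin)+
qed

text \<open>Induction on the total length. For three nonempty words both bracketings expand into
  seven terms, one for each nonempty set of last letters merged into the final position.\<close>

lemma qs_mult_assoc_word:
  assumes "comm_assoc_product br"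
  shows "qs_mult br (qshuffle br u v) (word w) = qs_mult br (word u) (qshuffle br v w)"
proof (induction "length u + length v + length w" arbitrary: u v w rule: less_induct)
  case less
  have br: "bilinear br" and br_assoc: "br (br x y) z = br x (br y z)" for x y z
    using assms by (auto simp: comm_assoc_product_def)
  note rec = qs_mult_append_letters [OF br]
  note add = bilinear_ladd [OF bilinear_qs_mult] bilinear_radd [OF bilinear_qs_mult]
    bilinear_ladd [OF bilinear_append_letters]
  let ?m = "qs_mult br" and ?A = append_letters
  consider "u = [] \<or> v = [] \<or> w = []"
    | u' a v' b w' c where "u = u' @ [a]" "v = v' @ [b]" "w = w' @ [c]"
    by (cases u rule: rev_cases; cases v rule: rev_cases; cases w rule: rev_cases) auto
  then show ?case
  proof cases
    case 1
    then show ?thesis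
      by (auto simp: qshuffle_Nil_left qshuffle_Nil_right)
  next
    case (2 u' a v' b w' c)
    have IH: "?m (?m (word x) (word y)) (word z) = ?m (word x) (?m (word y) (word z))"
      if "length x + length y + length z < length u + length v + length w" for x y z
      using less [OF that] by simp
    let ?a = "letter a" and ?b = "letter b" and ?c = "letter c"
    let ?u = "word u'" and ?v = "word v'" and ?w = "word w'"
    have ua: "word u = ?A ?u ?a" and vb: "word v = ?A ?v ?b" and wc: "word w = ?A ?w ?c"
      using 2 by (simp_all add: append_letters_word_letter)
    \<comment> \<open>One instance for each nonempty choice of words that lose their last
      letter.\<close>
    have IHs:
      "?m (?m ?u (word v)) (word w) = ?m ?u (?m (word v) (word w))"
      "?m (?m (word u) ?v) (word w) = ?m (word u) (?m ?v (word w))"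
      "?m (?m (word u) (word v)) ?w = ?m (word u) (?m (word v) ?w)"
      "?m (?m ?u ?v) (word w) = ?m ?u (?m ?v (word w))"
      "?m (?m ?u (word v)) ?w = ?m ?u (?m (word v) ?w)"
      "?m (?m (word u) ?v) ?w = ?m (word u) (?m ?v ?w)"
      "?m (?m ?u ?v) ?w = ?m ?u (?m ?v ?w)"
      by (rule IH; simp add: 2)+
    have uv: "?m (word u) (word v) = ?A (?m ?u (word v)) ?a + ?A (?m (word u) ?v) ?b
      + ?A (?m ?u ?v) (br ?a ?b)"
      unfolding ua vb by (rule rec)
    have vw: "?m (word v) (word w) = ?A (?m ?v (word w)) ?b + ?A (?m (word v) ?w) ?c
      + ?A (?m ?v ?w) (br ?b ?c)"
      unfolding vb wc by (rule rec)
    \<comment> \<open>The appended \<open>x\<close> stays general, since it will be a letter as well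
      as the bracket of two letters.\<close>
    have recl: "?m (?A p x) (word w) = ?A (?m p (word w)) x + ?A (?m (?A p x) ?w) ?c
      + ?A (?m p ?w) (br x ?c)" for p x
      unfolding wc by (rule rec)
    have recr: "?m (word u) (?A p x) = ?A (?m ?u (?A p x)) ?a + ?A (?m (word u) p) x
      + ?A (?m ?u p) (br ?a x)" for p x
      unfolding ua by (rule rec)
    \<comment> \<open>Unfolding \<open>uv\<close> also splits the term ending in \<open>?c\<close>
      on the right, which then matches the three such terms produced by \<open>recl\<close>.\<close>
    have "?m (?m (word u) (word v)) (word w) =
        ?A (?m (?m ?u (word v)) (word w)) ?a + ?A (?m (?m (word u) ?v) (word w)) ?b
      + ?A (?m (?m ?u ?v) (word w)) (br ?a ?b) + ?A (?m (?m (word u) (word v)) ?w) ?c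
      + ?A (?m (?m ?u (word v)) ?w) (br ?a ?c) + ?A (?m (?m (word u) ?v) ?w) (br ?b ?c)
      + ?A (?m (?m ?u ?v) ?w) (br (br ?a ?b) ?c)"
      unfolding uv by (simp only: add recl ac_simps)
    also have "\<dots> =
        ?A (?m ?u (?m (word v) (word w))) ?a + ?A (?m (word u) (?m ?v (word w))) ?b
      + ?A (?m ?u (?m ?v (word w))) (br ?a ?b) + ?A (?m (word u) (?m (word v) ?w)) ?c
      + ?A (?m ?u (?m (word v) ?w)) (br ?a ?c) + ?A (?m (word u) (?m ?v ?w)) (br ?b ?c)
      + ?A (?m ?u (?m ?v ?w)) (br ?a (br ?b ?c))"
      by (simp only: IHs br_assoc)
    also have "\<dots> = ?m (word u) (?m (word v) (word w))"
      unfolding vw by (simp only: add recr ac_simps)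
    finally show ?thesis
      by simp
  qed
qed

lemma qs_mult_assoc:
  assumes "comm_assoc_product br"
  shows "qs_mult br (qs_mult br p q) r = qs_mult br p (qs_mult br q r)"
proof -
  note lin = linear_ident
    bilinear_left [OF bilinear_qs_mult] bilinear_right [OF bilinear_qs_mult]
  let ?L = "\<lambda>p q r. qs_mult br (qs_mult br p q) r"
  let ?R = "\<lambda>p q r. qs_mult br p (qs_mult br q r)"
  have 1: "?L (word u) (word v) (word w) = ?R (word u) (word v) (word w)" for u v w
    by (simp add: qs_mult_assoc_word [OF assms])
  have 2: "?L (word u) (word v) r = ?R (word u) (word v) r" for u v
    by (rule linear_eqI_basis [of "\<lambda>x. ?L (word u) (word v) x"
          "\<lambda>x. ?R (word u) (word v) x", OF _ _ 1])
      (intro lin)+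
  have 3: "?L (word u) q r = ?R (word u) q r" for u
    by (rule linear_eqI_basis [of "\<lambda>x. ?L (word u) x r"
          "\<lambda>x. ?R (word u) x r", OF _ _ 2])
      (intro lin)+
  show ?thesis
    by (rule linear_eqI_basis [of "\<lambda>x. ?L x q r"
          "\<lambda>x. ?R x q r", OF _ _ 3])
      (intro lin)+
qed

lemma keys_lin_ext:
  fixes h :: "'b \<Rightarrow> 'c \<Rightarrow>\<^sub>0 real"
  shows "Poly_Mapping.keys (lin_ext h p) \<subseteq> (\<Union>x\<in>Poly_Mapping.keys p. Poly_Mapping.keys (h x))"
proof -
  have "Poly_Mapping.keys (lin_ext h p) \<subseteq>
      (\<Union>x\<in>Poly_Mapping.keys p. Poly_Mapping.keys (Poly_Mapping.lookup p x *\<^sub>R h x))"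
    unfolding lin_ext_def by (rule keys_sum)
  also have "\<dots> \<subseteq> (\<Union>x\<in>Poly_Mapping.keys p. Poly_Mapping.keys (h x))"
    by (auto simp: in_keys_iff)
  finally show ?thesis .
qed

section \<open>The convolution algebra\<close>

text \<open>A factorization is determined by the position of its cut.\<close>

lemma finite_splits [simp]: "finite {(u, v). u @ v = w}"
proof (rule finite_subset)
  show "{(u, v). u @ v = w} \<subseteq> (\<lambda>n. (take n w, drop n w)) ` {..length w}"
  proof clarify
    fix u v
    show "(u, v) \<in> (\<lambda>n. (take n (u @ v), drop n (u @ v))) ` {..length (u @ v)}"
      by (rule image_eqI [where x = "length u"]) auto
  qed
qed simp

lemma linear_conv: "linear (conv br X Y)"
  unfolding conv_def by (rule linear_lin_ext)

lemma linear_conv_unit: "linear conv_unit"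
  unfolding conv_unit_def by (rule linear_lin_ext)

lemma linear_conv_power: "linear (conv_power br X k)"
  by (cases k) (auto simp: linear_conv linear_conv_unit)

lemma conv_word:
  "conv br X Y (word w) = (\<Sum>(u, v)\<in>{(u, v). u @ v = w}. qs_mult br (X (word u)) (Y (word v)))"
  by (simp add: conv_def)

lemma conv_unit_word: "conv_unit (word w) = (if w = [] then word [] else 0)"
  by (simp add: conv_unit_def)

lemma conv_unit_left:
  assumes "linear Y"
  shows "conv br conv_unit Y = Y"
proof (rule ext, rule linear_eqI_basis [OF linear_conv assms])
  fix w :: "'a list"
  have "conv br conv_unit Y (word w) =
      (\<Sum>(u, v)\<in>{([], w)}. qs_mult br (conv_unit (word u)) (Y (word v)))"
    unfolding conv_word
    by (rule sum.mono_neutral_right)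
      (auto simp: conv_unit_word bilinear_lzero [OF bilinear_qs_mult] split: if_splits)
  then show "conv br conv_unit Y (word w) = Y (word w)"
    by (simp add: conv_unit_word)
qed

lemma conv_unit_right:
  assumes "linear X"
  shows "conv br X conv_unit = X"
proof (rule ext, rule linear_eqI_basis [OF linear_conv assms])
  fix w :: "'a list"
  have "conv br X conv_unit (word w) =
      (\<Sum>(u, v)\<in>{(w, [])}. qs_mult br (X (word u)) (conv_unit (word v)))"
    unfolding conv_word
    by (rule sum.mono_neutral_right)
      (auto simp: conv_unit_word bilinear_rzero [OF bilinear_qs_mult] split: if_splits)
  then show "conv br X conv_unit (word w) = X (word w)"
    by (simp add: conv_unit_word)
qed

text \<open>By associativity of \<open>qs_mult\<close>, both sides become the same sum over
  factorizations of \<open>w\<close> into three words.\<close>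

lemma conv_assoc:
  assumes "comm_assoc_product br"
  shows "conv br (conv br X Y) Z = conv br X (conv br Y Z)"
proof (rule ext, rule linear_eqI_basis [OF linear_conv linear_conv])
  fix w :: "'a list"
  let ?S = "\<lambda>w :: 'a list. {(u, v). u @ v = w}"
  let ?t = "\<lambda>a b c. qs_mult br (X (word a)) (qs_mult br (Y (word b)) (Z (word c)))"
  have "conv br (conv br X Y) Z (word w) =
      (\<Sum>p\<in>?S w. \<Sum>q\<in>?S (fst p). ?t (fst q) (snd q) (snd p))"
    by (simp add: conv_word case_prod_unfold bilinear_sum_left [OF bilinear_qs_mult]
        qs_mult_assoc [OF assms])
  also have "\<dots> = (\<Sum>(p, q)\<in>Sigma (?S w) (\<lambda>p. ?S (fst p)). ?t (fst q) (snd q) (snd p))"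
    by (rule sum.Sigma) auto
  \<comment> \<open>For \<open>w = x @ y @ z\<close>, the bijection matches
    \<open>((x @ y, z), (x, y))\<close> with \<open>((x, y @ z), (y, z))\<close>.\<close>
  also have "\<dots> = (\<Sum>(p, q)\<in>Sigma (?S w) (\<lambda>p. ?S (snd p)). ?t (fst p) (fst q) (snd q))"
    by (rule sum.reindex_bij_witness
        [where i = "\<lambda>(p, q). ((fst p @ fst q, snd q), (fst p, fst q))"
          and j = "\<lambda>(p, q). ((fst q, snd q @ snd p), (snd q, snd p))"]) auto
  also have "\<dots> = (\<Sum>p\<in>?S w. \<Sum>q\<in>?S (snd p). ?t (fst p) (fst q) (snd q))"
    by (rule sum.Sigma [symmetric]) auto
  also have "\<dots> = conv br X (conv br Y Z) (word w)"
    by (simp add: conv_word case_prod_unfold bilinear_sum_right [OF bilinear_qs_mult])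
  finally show "conv br (conv br X Y) Z (word w) = conv br X (conv br Y Z) (word w)" .
qed

lemma conv_power_add:
  assumes "comm_assoc_product br"
  shows "conv br (conv_power br X m) (conv_power br X n) = conv_power br X (m + n)"
  by (induction m) (simp_all add: conv_unit_left linear_conv_power conv_assoc [OF assms])

lemma keys_qs_mult:
  "Poly_Mapping.keys (qs_mult br p q) \<subseteq>
    (\<Union>u\<in>Poly_Mapping.keys p. \<Union>v\<in>Poly_Mapping.keys q. Poly_Mapping.keys (qshuffle br u v))"
  unfolding qs_mult_def
  by (rule order_trans [OF keys_lin_ext]) (intro UN_mono order_refl keys_lin_ext)

lemma lookup_qs_mult:
  "Poly_Mapping.lookup (qs_mult br p q) z =
    (\<Sum>(u, v)\<in>Poly_Mapping.keys p \<times> Poly_Mapping.keys q.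
      Poly_Mapping.lookup p u * Poly_Mapping.lookup q v * Poly_Mapping.lookup (qshuffle br u v) z)"
  by (simp add: qs_mult_def lin_ext_def lookup_sum sum.cartesian_product [symmetric]
      sum_distrib_left mult.assoc)

section \<open>Endomorphisms as tensors\<close>

definition endo_tensor :: "('a words \<Rightarrow> 'a words) \<Rightarrow> 'a ctensor" where
  "endo_tensor X = (\<lambda>(u, w). Poly_Mapping.lookup (X (word w)) u)"

lemma endo_tensor_apply [simp]:
  "endo_tensor X (u, w) = Poly_Mapping.lookup (X (word w)) u"
  by (simp add: endo_tensor_def)

text \<open>At each index the second tensor factor selects a single summand, so the infinite sum has
  only one term.\<close>

lemma ct_sum_eq_endo_tensor: "ct_sum (\<lambda>w. X (word w) \<otimes> word w) = endo_tensor X"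
proof (rule ext, clarify)
  fix u v
  have "(\<Sum>\<^sub>\<infinity>w. (X (word w) \<otimes> word w) (u, v)) = (\<Sum>\<^sub>\<infinity>w\<in>{v}. (X (word w) \<otimes> word w) (u, v))"
    by (rule infsum_cong_neutral) (auto simp: pure_tensor_def lookup_single when_def)
  then show "ct_sum (\<lambda>w. X (word w) \<otimes> word w) (u, v) = endo_tensor X (u, v)"
    by (simp add: ct_sum_def pure_tensor_def)
qed

text \<open>The coefficient at \<open>(z, w)\<close> receives contributions only from factorizations
  of \<open>w\<close> and from words in the two finite supports. The sum is therefore finite even
  over an infinite alphabet.\<close>

lemma has_sum_ct_mult_endo_tensor:
  "(ct_mult_term br (endo_tensor X) (endo_tensor Y) i has_sum endo_tensor (conv br X Y) i) UNIV"
proof -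
  obtain z w where i: "i = (z, w)"
    by (cases i)
  let ?f = "ct_mult_term br (endo_tensor X) (endo_tensor Y) i"
  define K where "K = (\<lambda>(x, y). Poly_Mapping.keys (X (word x)) \<times> Poly_Mapping.keys (Y (word y)))"
  define S where "S = Sigma {(x, y). x @ y = w} K"
  \<comment> \<open>Convolution groups the two factors of \<open>w\<close> together, the tensor
    product groups each factor with its image word; \<open>g\<close> translates between the
    two.\<close>
  define g :: "('a list \<times> 'a list) \<times> ('a list \<times> 'a list) \<Rightarrow> ('a list \<times> 'a list) \<times> ('a list \<times> 'a list)"
    where "g = (\<lambda>((x, y), (u, v)). ((u, x), (v, y)))"
  have fin: "finite S"
    unfolding S_def K_def by (intro finite_SigmaI) auto
  have inj: "inj_on g S"
    by (auto simp: inj_on_def g_def)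
  have "?f t = 0" if "t \<notin> g ` S" for t
  proof (rule ccontr)
    assume nz: "?f t \<noteq> 0"
    obtain u x v y where t: "t = ((u, x), (v, y))"
      by (metis prod.collapse)
    have "((x, y), (u, v)) \<in> S"
      using nz by (auto simp: t i S_def K_def ct_mult_term_def pure_tensor_def
          in_keys_iff lookup_single when_def split: if_splits)
    then have "t \<in> g ` S"
      by (rule rev_image_eqI) (simp add: t g_def)
    with that show False ..
  qed
  moreover have "endo_tensor (conv br X Y) i = sum ?f (g ` S)"
  proof -
    have "endo_tensor (conv br X Y) i = (\<Sum>p\<in>{(x, y). x @ y = w}. \<Sum>q\<in>K p. ?f (g (p, q)))"
      by (auto simp: i conv_word lookup_sum lookup_qs_mult K_def g_def
          ct_mult_term_def pure_tensor_def intro!: sum.cong)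
    also have "\<dots> = (\<Sum>(p, q)\<in>S. ?f (g (p, q)))"
      unfolding S_def by (rule sum.Sigma) (auto simp: K_def)
    also have "\<dots> = sum ?f (g ` S)"
      by (simp add: sum.reindex [OF inj] o_def case_prod_unfold)
    finally show ?thesis .
  qed
  ultimately show ?thesis
    using fin by (intro has_sum_finite_neutralI [where B = "g ` S"]) auto
qed

lemma ct_mult_endo_tensor:
  "ct_mult br (endo_tensor X) (endo_tensor Y) = endo_tensor (conv br X Y)"
  unfolding ct_mult_def using infsumI [OF has_sum_ct_mult_endo_tensor] by (rule ext)

lemma ct_power_endo_tensor: "ct_power br (endo_tensor X) k = endo_tensor (conv_power br X k)"
proof (induction k)
  case 0
  show ?case
    by (auto simp: fun_eq_iff pure_tensor_def conv_unit_word lookup_single when_def)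
qed (simp add: ct_mult_endo_tensor)

section \<open>Coefficientwise convergence of convolution series\<close>

lemma conv_series_sumsI:
  assumes "linear Y"
    and "\<And>w v. (\<lambda>k. c k * Poly_Mapping.lookup (conv_power br X k (word w)) v)
              sums Poly_Mapping.lookup (Y (word w)) v"
  shows "conv_series_sums br c X Y"
  unfolding conv_series_sums_def
proof (intro conjI allI assms(1))
  fix p v
  \<comment> \<open>An argument involves finitely many words, so the limits on words can be added
    up.\<close>
  have "(\<lambda>k. \<Sum>w\<in>Poly_Mapping.keys p. Poly_Mapping.lookup p w *
      (c k * Poly_Mapping.lookup (conv_power br X k (word w)) v))
    sums (\<Sum>w\<in>Poly_Mapping.keys p. Poly_Mapping.lookup p w * Poly_Mapping.lookup (Y (word w)) v)"
    by (intro sums_sum sums_mult assms(2))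
  then show "(\<lambda>k. c k * Poly_Mapping.lookup (conv_power br X k p) v) sums Poly_Mapping.lookup (Y p) v"
    by (simp add: linear_lookup_sum [OF assms(1), of p]
        linear_lookup_sum [OF linear_conv_power, of _ _ _ p]
        sum_distrib_left mult.left_commute)
qed

lemma conv_series_eqI:
  assumes "conv_series_sums br c X Y"
  shows "conv_series br c X = Y"
  unfolding conv_series_def
proof (rule the_equality)
  show "conv_series_sums br c X Y"
    by (rule assms)
  fix Z
  assume "conv_series_sums br c X Z"
  then have "Poly_Mapping.lookup (Z p) v = Poly_Mapping.lookup (Y p) v" for p v
    using assms unfolding conv_series_sums_def by (blast intro: sums_unique2)
  then show "Z = Y"
    by (intro ext poly_mapping_eqI)
qed

lemma conv_series_sums_conv_series:
  "conv_series_converges br c X \<Longrightarrow> conv_series_sums br c X (conv_series br c X)"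
  unfolding conv_series_converges_def by (auto simp: conv_series_eqI)

text \<open>This identifies the coefficient limits without yet requiring them to form an
  endomorphism.\<close>

lemma power_series_endo_tensor_sums:
  assumes "has_power_series_on br f c D" "endo_tensor X \<in> D"
  shows "(\<lambda>k. c k * Poly_Mapping.lookup (conv_power br X k (word w)) v) sums f (endo_tensor X) (v, w)"
proof -
  have "(\<lambda>k. c k * ct_power br (endo_tensor X) k (v, w)) sums f (endo_tensor X) (v, w)"
    using assms unfolding has_power_series_on_def by blast
  then show ?thesis
    by (simp add: ct_power_endo_tensor)
qed

lemma power_series_endo_tensor:
  assumes "has_power_series_on br f c D" "endo_tensor X \<in> D" "conv_series_converges br c X"
  shows "f (endo_tensor X) = endo_tensor (conv_series br c X)"
proof (rule ext, clarify)
  fix v w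
  have "(\<lambda>k. c k * Poly_Mapping.lookup (conv_power br X k (word w)) v)
      sums endo_tensor (conv_series br c X) (v, w)"
    using conv_series_sums_conv_series [OF assms(3)]
    by (simp add: conv_series_sums_def)
  then show "f (endo_tensor X) (v, w) = endo_tensor (conv_series br c X) (v, w)"
    using power_series_endo_tensor_sums [OF assms(1,2)] sums_unique2 by blast
qed

text \<open>The identity \<open>g (f s) = s\<close> at the tensor of \<open>X\<close>, read
  coefficientwise, says that the outer series converges to \<open>X\<close>. Its limit is thus known
  to be an endomorphism.\<close>

lemma conv_series_inverts_at_if_left_inverse:
  assumes "has_power_series_on br f c D" "has_power_series_on br g b E"
    and inv: "\<And>s. s \<in> D \<Longrightarrow> f s \<in> E \<and> g (f s) = s"
    and "linear X" "endo_tensor X \<in> D" "conv_series_converges br c X"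
  shows "conv_series_inverts_at br b c X"
proof -
  let ?Y = "conv_series br c X"
  have f: "f (endo_tensor X) = endo_tensor ?Y"
    using assms by (intro power_series_endo_tensor)
  have Y: "endo_tensor ?Y \<in> E" "g (endo_tensor ?Y) = endo_tensor X"
    using inv [OF \<open>endo_tensor X \<in> D\<close>] by (simp_all add: f)
  have "conv_series_sums br b ?Y X"
    using power_series_endo_tensor_sums [OF assms(2) Y(1)] \<open>linear X\<close>
    by (intro conv_series_sumsI) (simp_all add: Y(2))
  then show ?thesis
    by (auto simp: conv_series_inverts_at_def conv_series_converges_def conv_series_eqI)
qed

text \<open>An empty first factor reproduces the previous power, and a nonempty one leaves a shorter
  word; hence the words occurring in all the powers form a finite set.\<close>

lemma conv_power_id_finite_support:
  "\<exists>T. finite T \<and> (\<forall>k. Poly_Mapping.keys (conv_power br id k (word w)) \<subseteq> T)"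
proof (induction w rule: length_induct)
  case (1 w)
  then obtain T where T: "\<And>v. length v < length w \<Longrightarrow>
      finite (T v) \<and> (\<forall>k. Poly_Mapping.keys (conv_power br id k (word v)) \<subseteq> T v)"
    by metis
  let ?S = "{(u, v). u @ v = w}"
  \<comment> \<open>The empty word accounts for the power zero, the union for all nonempty first
    factors.\<close>
  define U where "U = insert [] (\<Union>(u, v)\<in>?S - {([], w)}. \<Union>x\<in>T v. Poly_Mapping.keys (qshuffle br u x))"
  have short: "length v < length w" if "(u, v) \<in> ?S - {([], w)}" for u v
    using that by (cases u) auto
  have "finite U"
    unfolding U_def using T short by (intro finite.insertI finite_UN_I finite_Diff finite_splits) auto
  moreover have "Poly_Mapping.keys (conv_power br id k (word w)) \<subseteq> U" for k
  proof (induction k)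
    case 0
    show ?case
      by (simp add: conv_unit_word U_def)
  next
    case (Suc k)
    let ?t = "\<lambda>(u, v). qs_mult br (word u) (conv_power br id k (word v))"
    have "conv_power br id (Suc k) (word w) = conv_power br id k (word w) + sum ?t (?S - {([], w)})"
      by (simp add: conv_word sum.remove [of _ "([], w)"])
    moreover have "Poly_Mapping.keys (?t p) \<subseteq> U" if "p \<in> ?S - {([], w)}" for p
    proof -
      obtain u v where p: "p = (u, v)"
        by (cases p)
      have "Poly_Mapping.keys (?t p) \<subseteq> (\<Union>x\<in>T v. Poly_Mapping.keys (qshuffle br u x))"
        using keys_qs_mult [of br "word u" "conv_power br id k (word v)"] T [OF short [of u v]] that
        unfolding p by fastforce
      also have "\<dots> \<subseteq> U"
        unfolding U_def using that p by blast
      finally show ?thesis .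
    qed
    ultimately show ?case
      using Suc keys_add [of "conv_power br id k (word w)" "sum ?t (?S - {([], w)})"]
        keys_sum [of ?t "?S - {([], w)}"]
      by (simp only:) blast
  qed
  ultimately show ?case
    by blast
qed

text \<open>The values of \<open>f\<close> give the limit coefficients. For each word they vanish
  outside the finite set supporting all powers, so they define an endomorphism.\<close>

lemma power_series_id_converges:
  assumes "has_power_series_on br f c D" "endo_tensor id \<in> D"
  shows "conv_series_converges br c id"
proof -
  let ?g = "\<lambda>w v. f (endo_tensor id) (v, w)"
  note sums = power_series_endo_tensor_sums [OF assms]
  have fin: "finite {v. ?g w v \<noteq> 0}" for w
  proof -
    obtain T where T: "finite T" "\<And>k. Poly_Mapping.keys (conv_power br id k (word w)) \<subseteq> T"
      using conv_power_id_finite_support by metis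
    have "?g w v = 0" if "v \<notin> T" for v
    proof -
      have "Poly_Mapping.lookup (conv_power br id k (word w)) v = 0" for k
        using T(2) [of k] that by (auto simp: in_keys_iff)
      then show ?thesis
        using sums [of w v] sums_unique2 [OF _ sums_zero] by auto
    qed
    then show ?thesis
      using T(1) by (auto intro: finite_subset [of _ T])
  qed
  have "conv_series_sums br c id (lin_ext (\<lambda>w. Abs_poly_mapping (?g w)))"
    by (intro conv_series_sumsI linear_lin_ext) (use sums in \<open>simp add: fin\<close>)
  then show ?thesis
    unfolding conv_series_converges_def by blast
qed

section \<open>Series in a locally nilpotent endomorphism\<close>

text \<open>With more convolution factors than letters, some factor receives the empty word, where
  \<open>X\<close> vanishes.\<close>

lemma conv_power_eq_0:
  assumes "X (word []) = 0"
  shows "length w < k \<Longrightarrow> conv_power br X k (word w) = 0"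
proof (induction k arbitrary: w)
  case (Suc k)
  have "qs_mult br (X (word u)) (conv_power br X k (word v)) = 0" if "u @ v = w" for u v
  proof (cases u)
    case Nil
    then show ?thesis
      by (simp add: assms bilinear_lzero [OF bilinear_qs_mult])
  next
    case Cons
    then have "conv_power br X k (word v) = 0"
      using Suc that by auto
    then show ?thesis
      by (simp add: bilinear_rzero [OF bilinear_qs_mult])
  qed
  then show ?case
    by (auto simp: conv_word intro!: sum.neutral)
qed simp

lemma conv_series_sums_nilpotent:
  assumes "X (word []) = 0"
  shows "conv_series_sums br c X
    (lin_ext (\<lambda>w. \<Sum>k\<le>length w. c k *\<^sub>R conv_power br X k (word w)))"
proof (intro conv_series_sumsI linear_lin_ext)
  fix w v
  have "(\<lambda>k. c k * Poly_Mapping.lookup (conv_power br X k (word w)) v)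
      sums (\<Sum>k\<le>length w. c k * Poly_Mapping.lookup (conv_power br X k (word w)) v)"
    by (rule sums_finite) (auto simp: conv_power_eq_0 [of X, OF assms])
  then show "(\<lambda>k. c k * Poly_Mapping.lookup (conv_power br X k (word w)) v)
      sums Poly_Mapping.lookup (lin_ext (\<lambda>w. \<Sum>k\<le>length w. c k *\<^sub>R conv_power br X k (word w)) (word w)) v"
    by (simp add: lookup_sum)
qed

text \<open>A free bound \<open>N\<close> allows the same summation range for a word and all its
  factors.\<close>

lemma conv_series_nilpotent_word:
  assumes "X (word []) = 0" "length w \<le> N"
  shows "conv_series br c X (word w) = (\<Sum>k\<le>N. c k *\<^sub>R conv_power br X k (word w))"
proof -
  have "conv_series br c X (word w) = (\<Sum>k\<le>length w. c k *\<^sub>R conv_power br X k (word w))"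
    using conv_series_eqI [OF conv_series_sums_nilpotent [of X, OF assms(1)]] by simp
  also have "\<dots> = (\<Sum>k\<le>N. c k *\<^sub>R conv_power br X k (word w))"
    by (rule sum.mono_neutral_left) (use assms in \<open>auto simp: conv_power_eq_0 [of X]\<close>)
  finally show ?thesis .
qed

text \<open>A truncated Cauchy product: the square of indices shrinks to the triangle
  \<open>k + l \<le> N\<close>, whose diagonals give the coefficients of
  \<open>F * G\<close>.\<close>

lemma sum_product_truncated:
  fixes P :: "nat \<Rightarrow> 'v::real_vector"
  assumes "\<And>m. m > N \<Longrightarrow> P m = 0"
  shows "(\<Sum>k\<le>N. \<Sum>l\<le>N. (fps_nth F k * fps_nth G l) *\<^sub>R P (k + l)) =
    (\<Sum>m\<le>N. fps_nth (F * G) m *\<^sub>R P m)"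
proof -
  let ?f = "\<lambda>k l. (fps_nth F k * fps_nth G l) *\<^sub>R P (k + l)"
  have "(\<Sum>k\<le>N. \<Sum>l\<le>N. ?f k l) = (\<Sum>(k, l)\<in>{..N} \<times> {..N}. ?f k l)"
    by (rule sum.cartesian_product)
  also have "\<dots> = (\<Sum>(k, l)\<in>{(k, l). k + l \<le> N}. ?f k l)"
    by (rule sum.mono_neutral_right) (auto intro: ccontr simp: assms)
  also have "\<dots> = (\<Sum>m\<le>N. \<Sum>k\<le>m. ?f k (m - k))"
    by (rule sum.triangle_reindex_eq)
  also have "\<dots> = (\<Sum>m\<le>N. fps_nth (F * G) m *\<^sub>R P m)"
    by (auto simp: fps_mult_nth scaleR_sum_left atLeast0AtMost intro!: sum.cong)
  finally show ?thesis .
qed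

text \<open>Substituting \<open>X\<close> turns products of formal series into convolutions, hence
  powers into convolution powers.\<close>

lemma conv_power_conv_series:
  assumes br: "comm_assoc_product br" and X: "X (word []) = 0"
  shows "length w \<le> N \<Longrightarrow> conv_power br (conv_series br c X) j (word w) =
    (\<Sum>k\<le>N. fps_nth (Abs_fps c ^ j) k *\<^sub>R conv_power br X k (word w))"
proof (induction j arbitrary: w)
  case 0
  have "(\<Sum>k\<le>N. fps_nth (Abs_fps c ^ 0) k *\<^sub>R conv_power br X k (word w)) =
      (\<Sum>k\<in>{0}. fps_nth (Abs_fps c ^ 0) k *\<^sub>R conv_power br X k (word w))"
    by (rule sum.mono_neutral_right) auto
  then show ?case
    by simp
next
  case (Suc j)
  let ?S = "{(u, v). u @ v = w}" and ?F = "Abs_fps c"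
  let ?P = "\<lambda>k u. conv_power br X k (word u)"
  have len: "length u \<le> N" "length v \<le> N" if "(u, v) \<in> ?S" for u v
    using that Suc.prems by auto
  have "conv_power br (conv_series br c X) (Suc j) (word w) =
      (\<Sum>(u, v)\<in>?S. qs_mult br (\<Sum>k\<le>N. c k *\<^sub>R ?P k u) (\<Sum>l\<le>N. fps_nth (?F ^ j) l *\<^sub>R ?P l v))"
    unfolding conv_power.simps conv_word
    by (intro sum.cong refl) (use len in \<open>auto simp: conv_series_nilpotent_word [of X _ N, OF X] Suc.IH\<close>)
  also have "\<dots> = (\<Sum>(u, v)\<in>?S. \<Sum>k\<le>N. \<Sum>l\<le>N.
      (c k * fps_nth (?F ^ j) l) *\<^sub>R qs_mult br (?P k u) (?P l v))"
    by (simp add: bilinear_sum [OF bilinear_qs_mult] sum.cartesian_product [symmetric]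
        bilinear_lmul [OF bilinear_qs_mult] bilinear_rmul [OF bilinear_qs_mult] mult.commute)
  \<comment> \<open>Moving the factorizations innermost exposes the convolution of two powers of
    \<open>X\<close>.\<close>
  also have "\<dots> = (\<Sum>k\<le>N. \<Sum>l\<le>N. (c k * fps_nth (?F ^ j) l) *\<^sub>R
      (\<Sum>(u, v)\<in>?S. qs_mult br (?P k u) (?P l v)))"
    unfolding case_prod_unfold scaleR_sum_right
    by (subst sum.swap, intro sum.cong refl, rule sum.swap)
  also have "\<dots> = (\<Sum>k\<le>N. \<Sum>l\<le>N. (fps_nth ?F k * fps_nth (?F ^ j) l) *\<^sub>R ?P (k + l) w)"
    by (simp add: conv_word [symmetric] conv_power_add [OF br])
  also have "\<dots> = (\<Sum>m\<le>N. fps_nth (?F * ?F ^ j) m *\<^sub>R ?P m w)"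
    by (rule sum_product_truncated) (use Suc.prems in \<open>simp add: conv_power_eq_0 [of X, OF X]\<close>)
  finally show ?case
    by simp
qed

text \<open>On each word the iterated series is a finite sum in powers of \<open>X\<close> with the
  coefficients of the composed formal series, which is \<open>fps_X\<close>.\<close>

lemma conv_series_inverts_at_if_fps_inverse:
  assumes br: "comm_assoc_product br" and X: "linear X" "X (word []) = 0"
    and c: "c 0 = 0" and bc: "Abs_fps b oo Abs_fps c = fps_X"
  shows "conv_series_inverts_at br b c X"
proof -
  let ?Y = "conv_series br c X" and ?F = "Abs_fps c"
  \<comment> \<open>Because \<open>c 0 = 0\<close>, the inner series is locally nilpotent too, and
    the outer one is again finite on words.\<close>
  have Y: "?Y (word []) = 0"
    using conv_series_nilpotent_word [of X "[]" 0 br c] X c by simp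
  note sums = conv_series_sums_nilpotent [of ?Y br b, OF Y]
  then have lin: "linear (conv_series br b ?Y)"
    by (simp add: conv_series_eqI linear_lin_ext)
  have "conv_series br b ?Y p = X p" for p
  proof (rule linear_eqI_basis [OF lin X(1)])
    fix w :: "'a list"
    \<comment> \<open>The successor keeps index 1 in range even for the empty word.\<close>
    define N where "N = Suc (length w)"
    let ?P = "\<lambda>k. conv_power br X k (word w)"
    have "conv_series br b ?Y (word w) = (\<Sum>j\<le>N. b j *\<^sub>R (\<Sum>k\<le>N. fps_nth (?F ^ j) k *\<^sub>R ?P k))"
      using conv_series_nilpotent_word [of ?Y w N br b, OF Y]
        conv_power_conv_series [of br X w N c, OF br X(2)]
      by (simp add: N_def)
    also have "\<dots> = (\<Sum>k\<le>N. (\<Sum>j\<le>N. b j * fps_nth (?F ^ j) k) *\<^sub>R ?P k)"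
      by (simp add: scaleR_sum_right scaleR_sum_left) (rule sum.swap)
    also have "\<dots> = (\<Sum>k\<le>N. fps_nth (Abs_fps b oo ?F) k *\<^sub>R ?P k)"
    proof (intro sum.cong refl)
      fix k
      assume "k \<in> {..N}"
      \<comment> \<open>As \<open>?F\<close> has no constant term, \<open>?F ^ j\<close> contributes
        to degree \<open>k\<close> only for \<open>j \<le> k\<close>.\<close>
      then have "(\<Sum>j\<le>N. b j * fps_nth (?F ^ j) k) = (\<Sum>j=0..k. b j * fps_nth (?F ^ j) k)"
        by (intro sum.mono_neutral_right) (use startsby_zero_power_prefix [of ?F] c in auto)
      then show "(\<Sum>j\<le>N. b j * fps_nth (?F ^ j) k) *\<^sub>R ?P k = fps_nth (Abs_fps b oo ?F) k *\<^sub>R ?P k"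
        by (simp add: fps_compose_nth)
    qed
    also have "\<dots> = (\<Sum>k\<in>{1}. fps_nth fps_X k *\<^sub>R ?P k)"
      unfolding bc by (rule sum.mono_neutral_right) (auto simp: N_def)
    also have "\<dots> = X (word w)"
      by (simp add: conv_unit_right [OF X(1)])
    finally show "conv_series br b ?Y (word w) = X (word w)" .
  qed
  then show ?thesis
    using sums by (auto simp: conv_series_inverts_at_def conv_series_converges_def)
qed

text \<open>Inversion is treated in two readings: for mutually inverse functions on domains of
  convergence, and for formal series, where vanishing at the empty word secures convergence.\<close>

theorem proposition2:
  fixes br :: "'a::countable letters \<Rightarrow> 'a letters \<Rightarrow> 'a letters"
    and f :: "'a ctensor \<Rightarrow> 'a ctensor"
    and c :: "nat \<Rightarrow> real"
    and D :: "'a ctensor set"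
  assumes br: "comm_assoc_product br"
    and f: "has_power_series_on br f c D"
  shows
    "(ct_sum (\<lambda>w. word w \<otimes> word w) \<in> D \<longrightarrow>
        conv_series_converges br c id \<and>
        f (ct_sum (\<lambda>w. word w \<otimes> word w)) =
          ct_sum (\<lambda>w. conv_series br c id (word w) \<otimes> word w))
     \<and>
     (\<forall>g b E.
        has_power_series_on br g b E \<and>
        (\<forall>s\<in>D. f s \<in> E \<and> g (f s) = s) \<and> (\<forall>t\<in>E. g t \<in> D \<and> f (g t) = t) \<longrightarrow>
          (\<forall>X. linear X \<and> ct_sum (\<lambda>w. X (word w) \<otimes> word w) \<in> D \<and>
               conv_series_converges br c X \<longrightarrow> conv_series_inverts_at br b c X) \<and>
          (\<forall>Y. linear Y \<and> ct_sum (\<lambda>w. Y (word w) \<otimes> word w) \<in> E \<and>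
               conv_series_converges br b Y \<longrightarrow> conv_series_inverts_at br c b Y))
     \<and>
     (\<forall>b. c 0 = 0 \<and> b 0 = 0 \<and>
          Abs_fps b oo Abs_fps c = fps_X \<and> Abs_fps c oo Abs_fps b = fps_X \<longrightarrow>
          (\<forall>X. linear X \<and> X (word []) = 0 \<longrightarrow>
             conv_series_converges br c X \<and> conv_series_inverts_at br b c X \<and>
             conv_series_converges br b X \<and> conv_series_inverts_at br c b X))"
    (is "?id \<and> ?inverse \<and> ?formal")
proof (intro conjI)
  have id: "ct_sum (\<lambda>w. word w \<otimes> word w) = endo_tensor id"
    using ct_sum_eq_endo_tensor [of id] by simp
  show ?id
    unfolding id ct_sum_eq_endo_tensor
    using power_series_id_converges [OF f] power_series_endo_tensor [OF f] by blast
  show ?inverse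
    unfolding ct_sum_eq_endo_tensor
    \<comment> \<open>The lemma serves both directions, with the two functions and their data
      exchanged.\<close>
    using f by (blast intro: conv_series_inverts_at_if_left_inverse)
  have "conv_series_converges br c' X" if "X (word []) = 0" for c' X
    using conv_series_sums_nilpotent [of X, OF that] unfolding conv_series_converges_def by blast
  then show ?formal
    by (blast intro: conv_series_inverts_at_if_fps_inverse [OF br])
qed

end
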